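(* Let $\mu$ be a positive measure such that $L_1(\mu)$ is a dual space, and let $F$ be a finite dimensional subspace of $L_1(\mu)$. Then $F$ consists of SSD-points of $L_1(\mu)$ (i.e. every element of $F$ is an SSD-point of $L_1(\mu)$) if and only if there exists a positive integer $k$ such that $F \subset \ell_1(k)$ and $L_1(\mu) = \ell_1(k) \bigoplus_1 N$ for a subspace $N$ of $L_1(\mu)$.
   Context: All Banach spaces are over $\mathbb{R}$ and all subspaces are closed. "$L_1(\mu)$ is a dual space" means that it is isometric to $X^*$ for some Banach space $X$. $B_X$ denotes the closed unit ball of $X$. A vector $x$ in a Banach space $X$ is an SSD-point (point of strong subdifferentiability) of $X$ if the one-sided limit $\lim_{t\to 0^+}\frac{\|x+th\|-\|x\|}{t}$ exists uniformly for $h\in B_X$. $\ell_1(k)$ is $\mathbb{R}^k$ with the $\ell_1$-norm, and $\bigoplus_1$ denotes the $\ell_1$-direct sum. The notation $F\subset \ell_1(k)$ and $L_1(\mu)=\ell_1(k)\bigoplus_1 N$ means that there is a subspace $E$ of $L_1(\mu)$, linearly isometric to $\ell_1(k)$, with $F\subset E$, such that $L_1(\mu)$ is the direct sum of $E$ and $N$ and $\|e+n\|=\|e\|+\|n\|$ for all $e\in E$, $n\in N$.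
   Formalization: The formal statement additionally assumes that L_1(μ) is not {0}; for L_1(μ) = {0} and F = {0}, F consists of SSD-points but no copy of ℓ_1(k) with k positive exists, so the claim as stated fails there. *)

theory Defs
  imports "HOL-Analysis.Analysis"
begin

text \<open>
  \<open>L\<^sub>1(\<mu>)\<close> depends on the measure, a term, so it cannot be an instance of the type classes for
  normed spaces.  We use real normed spaces with an explicit carrier.
\<close>

record 'v nspace =
  ns_carrier :: "'v set"
  ns_add :: "'v \<Rightarrow> 'v \<Rightarrow> 'v"
  ns_zero :: 'v
  ns_scale :: "real \<Rightarrow> 'v \<Rightarrow> 'v"
  ns_norm :: "'v \<Rightarrow> real"

locale real_nspace =
  fixes V :: "('v, 'm) nspace_scheme"
  assumes zero_closed: "ns_zero V \<in> ns_carrier V"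
    and add_closed: "\<lbrakk>x \<in> ns_carrier V; y \<in> ns_carrier V\<rbrakk> \<Longrightarrow> ns_add V x y \<in> ns_carrier V"
    and scale_closed: "x \<in> ns_carrier V \<Longrightarrow> ns_scale V c x \<in> ns_carrier V"
    and add_assoc: "\<lbrakk>x \<in> ns_carrier V; y \<in> ns_carrier V; z \<in> ns_carrier V\<rbrakk>
      \<Longrightarrow> ns_add V (ns_add V x y) z = ns_add V x (ns_add V y z)"
    and add_commute: "\<lbrakk>x \<in> ns_carrier V; y \<in> ns_carrier V\<rbrakk> \<Longrightarrow> ns_add V x y = ns_add V y x"
    and add_zero: "x \<in> ns_carrier V \<Longrightarrow> ns_add V x (ns_zero V) = x"
    and scale_add_right: "\<lbrakk>x \<in> ns_carrier V; y \<in> ns_carrier V\<rbrakk>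
      \<Longrightarrow> ns_scale V c (ns_add V x y) = ns_add V (ns_scale V c x) (ns_scale V c y)"
    and scale_add_left: "x \<in> ns_carrier V
      \<Longrightarrow> ns_scale V (c + d) x = ns_add V (ns_scale V c x) (ns_scale V d x)"
    and scale_scale: "x \<in> ns_carrier V \<Longrightarrow> ns_scale V c (ns_scale V d x) = ns_scale V (c * d) x"
    and scale_one: "x \<in> ns_carrier V \<Longrightarrow> ns_scale V 1 x = x"
    and scale_zero: "x \<in> ns_carrier V \<Longrightarrow> ns_scale V 0 x = ns_zero V"
    and norm_nonneg: "x \<in> ns_carrier V \<Longrightarrow> 0 \<le> ns_norm V x"
    and norm_eq_0: "x \<in> ns_carrier V \<Longrightarrow> ns_norm V x = 0 \<longleftrightarrow> x = ns_zero V"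
    and norm_scale: "x \<in> ns_carrier V \<Longrightarrow> ns_norm V (ns_scale V c x) = \<bar>c\<bar> * ns_norm V x"
    and norm_triangle: "\<lbrakk>x \<in> ns_carrier V; y \<in> ns_carrier V\<rbrakk>
      \<Longrightarrow> ns_norm V (ns_add V x y) \<le> ns_norm V x + ns_norm V y"

definition type_nspace :: "'v::real_normed_vector nspace" where
  "type_nspace = \<lparr>ns_carrier = UNIV, ns_add = (+), ns_zero = 0, ns_scale = (*\<^sub>R), ns_norm = norm\<rparr>"

definition ell1 :: "nat \<Rightarrow> (nat \<Rightarrow> real) nspace" where
  "ell1 k = \<lparr>ns_carrier = {a. \<forall>i\<ge>k. a i = 0},
     ns_add = (\<lambda>a b i. a i + b i), ns_zero = (\<lambda>i. 0), ns_scale = (\<lambda>c a i. c * a i),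
     ns_norm = (\<lambda>a. \<Sum>i<k. \<bar>a i\<bar>)\<rparr>"

definition ae_eq_rel :: "'a measure \<Rightarrow> (('a \<Rightarrow> real) \<times> ('a \<Rightarrow> real)) set" where
  "ae_eq_rel M = {(f, g). integrable M f \<and> integrable M g \<and> (AE x in M. f x = g x)}"

text \<open>
  The operations are defined through representatives; the lemmas \<open>L1_add\<close>, \<open>L1_scale\<close>
  and \<open>L1_norm\<close> below show that they do not depend on the choice.
\<close>

definition L1 :: "'a measure \<Rightarrow> ('a \<Rightarrow> real) set nspace" where
  "L1 M = \<lparr>ns_carrier = {f. integrable M f} // ae_eq_rel M,
     ns_add = (\<lambda>A B. \<Union>f\<in>A. \<Union>g\<in>B. ae_eq_rel M `` {\<lambda>x. f x + g x}),
     ns_zero = ae_eq_rel M `` {\<lambda>x. 0},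
     ns_scale = (\<lambda>c A. \<Union>f\<in>A. ae_eq_rel M `` {\<lambda>x. c * f x}),
     ns_norm = (\<lambda>A. the_elem ((\<lambda>f. \<integral>x. \<bar>f x\<bar> \<partial>M) ` A))\<rparr>"

text \<open>The value outside the carrier only serves to meet the unrestricted axioms of \<open>Metric_space\<close>.\<close>

definition ns_dist :: "('v, 'm) nspace_scheme \<Rightarrow> 'v \<Rightarrow> 'v \<Rightarrow> real" where
  "ns_dist V x y = (if x \<in> ns_carrier V \<and> y \<in> ns_carrier V
     then ns_norm V (ns_add V x (ns_scale V (-1) y)) else 0)"

definition ns_topology :: "('v, 'm) nspace_scheme \<Rightarrow> 'v topology" where
  "ns_topology V = Metric_space.mtopology (ns_carrier V) (ns_dist V)"

definition linear_subspace :: "('v, 'm) nspace_scheme \<Rightarrow> 'v set \<Rightarrow> bool" where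
  "linear_subspace V S \<longleftrightarrow> S \<subseteq> ns_carrier V \<and> ns_zero V \<in> S \<and>
     (\<forall>x\<in>S. \<forall>y\<in>S. ns_add V x y \<in> S) \<and> (\<forall>c. \<forall>x\<in>S. ns_scale V c x \<in> S)"

definition closed_subspace :: "('v, 'm) nspace_scheme \<Rightarrow> 'v set \<Rightarrow> bool" where
  "closed_subspace V S \<longleftrightarrow> linear_subspace V S \<and> closedin (ns_topology V) S"

definition finite_dimensional :: "('v, 'm) nspace_scheme \<Rightarrow> 'v set \<Rightarrow> bool" where
  "finite_dimensional V S \<longleftrightarrow> (\<exists>B. finite B \<and> B \<subseteq> ns_carrier V \<and> S = linear_subspace V hull B)"

definition lin_isometric :: "('v, 'm) nspace_scheme \<Rightarrow> ('w, 'n) nspace_scheme \<Rightarrow> bool" where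
  "lin_isometric V W \<longleftrightarrow> (\<exists>T. bij_betw T (ns_carrier V) (ns_carrier W) \<and>
     (\<forall>x\<in>ns_carrier V. \<forall>y\<in>ns_carrier V. T (ns_add V x y) = ns_add W (T x) (T y)) \<and>
     (\<forall>c. \<forall>x\<in>ns_carrier V. T (ns_scale V c x) = ns_scale W c (T x)) \<and>
     (\<forall>x\<in>ns_carrier V. ns_norm W (T x) = ns_norm V x))"

text \<open>
  The predual is a type here: a hypothesis \<open>is_dual_of V TYPE('x)\<close> with free \<open>'x :: banach\<close>
  says that \<open>V\<close> is the dual of some Banach space, since the theorem then holds for every \<open>'x\<close>.
\<close>

definition is_dual_of :: "('v, 'm) nspace_scheme \<Rightarrow> 'x::banach itself \<Rightarrow> bool" where
  "is_dual_of V X \<longleftrightarrow> lin_isometric V (type_nspace :: ('x \<Rightarrow>\<^sub>L real) nspace)"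

definition SSD_point :: "('v, 'm) nspace_scheme \<Rightarrow> 'v \<Rightarrow> bool" where
  "SSD_point V x \<longleftrightarrow> x \<in> ns_carrier V \<and>
     (\<exists>l. uniform_limit {h \<in> ns_carrier V. ns_norm V h \<le> 1}
        (\<lambda>t h. (ns_norm V (ns_add V x (ns_scale V t h)) - ns_norm V x) / t) l (at_right 0))"

definition l1_direct_sum :: "('v, 'm) nspace_scheme \<Rightarrow> 'v set \<Rightarrow> 'v set \<Rightarrow> bool" where
  "l1_direct_sum V E N \<longleftrightarrow> closed_subspace V E \<and> closed_subspace V N \<and>
     bij_betw (\<lambda>(e, n). ns_add V e n) (E \<times> N) (ns_carrier V) \<and>
     (\<forall>e\<in>E. \<forall>n\<in>N. ns_norm V (ns_add V e n) = ns_norm V e + ns_norm V n)"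

lemma equiv_ae_eq_rel: "equiv {f. integrable M f} (ae_eq_rel M)"
proof (intro equivI)
  show "trans (ae_eq_rel M)"
  proof (rule transI)
    fix f g h assume fg: "(f, g) \<in> ae_eq_rel M" and gh: "(g, h) \<in> ae_eq_rel M"
    from fg have "AE x in M. f x = g x" by (simp add: ae_eq_rel_def)
    moreover from gh have "AE x in M. g x = h x" by (simp add: ae_eq_rel_def)
    ultimately have "AE x in M. f x = h x" by eventually_elim simp
    with fg gh show "(f, h) \<in> ae_eq_rel M" by (simp add: ae_eq_rel_def)
  qed
  show "sym (ae_eq_rel M)" by (rule symI) (simp add: ae_eq_rel_def eq_commute)
qed (auto simp: ae_eq_rel_def refl_on_def)

lemma ae_eq_rel_class_eq:
  assumes "integrable M f" "integrable M g"
  shows "ae_eq_rel M `` {f} = ae_eq_rel M `` {g} \<longleftrightarrow> (AE x in M. f x = g x)"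
  using assms by (subst eq_equiv_class_iff[OF equiv_ae_eq_rel]) (auto simp: ae_eq_rel_def)

lemma L1_add:
  assumes "integrable M f" "integrable M g"
  shows "ns_add (L1 M) (ae_eq_rel M `` {f}) (ae_eq_rel M `` {g}) = ae_eq_rel M `` {\<lambda>x. f x + g x}"
proof -
  have "congruent2 (ae_eq_rel M) (ae_eq_rel M) (\<lambda>f g. ae_eq_rel M `` {\<lambda>x. f x + g x})"
    by (rule congruent2I') (subst ae_eq_rel_class_eq, auto simp: ae_eq_rel_def)
  from UN_equiv_class2[OF equiv_ae_eq_rel equiv_ae_eq_rel this] assms
  show ?thesis by (simp add: L1_def)
qed

lemma L1_scale:
  assumes "integrable M f"
  shows "ns_scale (L1 M) c (ae_eq_rel M `` {f}) = ae_eq_rel M `` {\<lambda>x. c * f x}"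
proof -
  have "congruent (ae_eq_rel M) (\<lambda>f. ae_eq_rel M `` {\<lambda>x. c * f x})"
    by (rule congruentI) (subst ae_eq_rel_class_eq, auto simp: ae_eq_rel_def)
  from UN_equiv_class[OF equiv_ae_eq_rel this] assms show ?thesis by (simp add: L1_def)
qed

lemma L1_norm:
  assumes "integrable M f"
  shows "ns_norm (L1 M) (ae_eq_rel M `` {f}) = (\<integral>x. \<bar>f x\<bar> \<partial>M)"
proof -
  have eq: "(\<integral>x. \<bar>g x\<bar> \<partial>M) = (\<integral>x. \<bar>f x\<bar> \<partial>M)" if "(f, g) \<in> ae_eq_rel M" for g
    using that by (intro integral_cong_AE) (auto simp: ae_eq_rel_def)
  have "f \<in> ae_eq_rel M `` {f}" using assms by (simp add: ae_eq_rel_def)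
  then have "(\<lambda>f. \<integral>x. \<bar>f x\<bar> \<partial>M) ` (ae_eq_rel M `` {f}) = {\<integral>x. \<bar>f x\<bar> \<partial>M}"
    using eq by (intro set_eqI iffI) (blast, blast)
  then show ?thesis by (simp add: L1_def)
qed

lemma L1_carrier: "ns_carrier (L1 M) = (\<lambda>f. ae_eq_rel M `` {f}) ` {f. integrable M f}"
  by (auto simp: L1_def quotient_def)

lemma L1_zero: "ns_zero (L1 M) = ae_eq_rel M `` {\<lambda>x. 0}"
  by (simp add: L1_def)

lemma real_nspace_L1: "real_nspace (L1 M)"
proof
  fix A B assume "A \<in> ns_carrier (L1 M)" "B \<in> ns_carrier (L1 M)"
  then obtain f g where fg: "integrable M f" "integrable M g"
    "A = ae_eq_rel M `` {f}" "B = ae_eq_rel M `` {g}" by (auto simp: L1_carrier)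
  have "(\<integral>x. \<bar>f x + g x\<bar> \<partial>M) \<le> (\<integral>x. \<bar>f x\<bar> + \<bar>g x\<bar> \<partial>M)"
    using fg by (intro integral_mono) auto
  with fg show "ns_norm (L1 M) (ns_add (L1 M) A B) \<le> ns_norm (L1 M) A + ns_norm (L1 M) B"
    by (simp add: L1_add L1_norm)
next
  fix A assume "A \<in> ns_carrier (L1 M)"
  then obtain f where f: "integrable M f" "A = ae_eq_rel M `` {f}" by (auto simp: L1_carrier)
  then show "ns_norm (L1 M) A = 0 \<longleftrightarrow> A = ns_zero (L1 M)"
    by (simp add: L1_norm L1_zero ae_eq_rel_class_eq integral_nonneg_eq_0_iff_AE)
qed (auto simp: L1_carrier L1_zero L1_add L1_scale L1_norm abs_mult algebra_simps)

lemma (in real_nspace) Metric_space_ns_dist: "Metric_space (ns_carrier V) (ns_dist V)"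
proof
  have neg: "ns_add V x (ns_scale V (-1) x) = ns_zero V" if "x \<in> ns_carrier V" for x
    using scale_add_left[OF that, of 1 "-1"] that by (simp add: scale_one scale_zero)
  have split: "ns_add V (ns_add V x (ns_scale V (-1) y)) (ns_add V y (ns_scale V (-1) z)) =
      ns_add V x (ns_scale V (-1) z)"
    if "x \<in> ns_carrier V" "y \<in> ns_carrier V" "z \<in> ns_carrier V" for x y z
  proof -
    have "ns_add V (ns_scale V (-1) y) (ns_add V y (ns_scale V (-1) z)) = ns_scale V (-1) z"
      using that by (metis add_assoc add_commute add_zero neg scale_closed zero_closed)
    then show ?thesis using that by (simp add: add_assoc add_closed scale_closed)
  qed
  show "0 \<le> ns_dist V x y" for x y
    by (simp add: ns_dist_def norm_nonneg add_closed scale_closed)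
  show "ns_dist V x y = ns_dist V y x" for x y
  proof (cases "x \<in> ns_carrier V \<and> y \<in> ns_carrier V")
    case True
    then have "ns_scale V (-1) (ns_add V x (ns_scale V (-1) y)) = ns_add V y (ns_scale V (-1) x)"
      by (simp add: scale_add_right scale_scale scale_closed scale_one add_commute)
    with True norm_scale[of "ns_add V x (ns_scale V (-1) y)" "-1"] show ?thesis
      by (simp add: ns_dist_def add_closed scale_closed)
  qed (auto simp: ns_dist_def)
  show "ns_dist V x y = 0 \<longleftrightarrow> x = y" if "x \<in> ns_carrier V" "y \<in> ns_carrier V" for x y
  proof -
    have "x = y" if "ns_add V x (ns_scale V (-1) y) = ns_zero V"
      using that \<open>x \<in> ns_carrier V\<close> \<open>y \<in> ns_carrier V\<close>
      by (metis add_assoc add_commute add_zero neg scale_closed zero_closed)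
    then show ?thesis using that neg
      by (auto simp: ns_dist_def norm_eq_0 add_closed scale_closed)
  qed
  show "ns_dist V x z \<le> ns_dist V x y + ns_dist V y z"
    if "x \<in> ns_carrier V" "y \<in> ns_carrier V" "z \<in> ns_carrier V" for x y z
    using norm_triangle[of "ns_add V x (ns_scale V (-1) y)" "ns_add V y (ns_scale V (-1) z)"] that
    by (simp add: ns_dist_def split add_closed scale_closed)
qed

end

theory Submission
  imports Defs
begin

text \<open>
  If \<open>f\<close> is an SSD-point of \<open>L\<^sub>1(\<mu>)\<close>, then the non-null subsets \<open>A\<close> of its support satisfy
  \<open>\<integral>\<^sub>A \<bar>f\<bar> \<ge> \<epsilon>\<close> for a fixed \<open>\<epsilon> > 0\<close>, so the support is a finite union of atoms.  The same holds
  for an extreme point of the unit ball; duality provides one, and hence at least one atom even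
  when \<open>F = {0}\<close>.  Adding the absolute values over a finite generating set of \<open>F\<close> and over such an
  extreme point yields a single \<open>g\<close> whose support \<open>U\<close> is a finite union of disjoint atoms
  \<open>A\<^sub>i\<close>.  Integrable functions are multiples of \<open>\<bar>g\<bar>\<close> on each \<open>A\<^sub>i\<close>, so the functions supported on
  \<open>U\<close> form a copy of \<open>\<ell>\<^sub>1(k)\<close>, and those vanishing on \<open>U\<close> are its complement.  Conversely, on an
  \<open>\<ell>\<^sub>1(k)\<close>-summand the difference quotients are constant for small \<open>t\<close>, uniformly on the unit ball.
\<close>

subsection \<open>Extreme points of dual unit balls\<close>

text \<open>This is the existence half of the Krein-Milman argument. Zorn's lemma gives a minimal
  closed face; the points of a face where a fixed coordinate is maximal form a smaller closed face,
  so every coordinate is constant on the minimal one, which is therefore a single point.\<close>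

lemma compact_extreme_point:
  fixes K :: "('i \<Rightarrow> real) set"
  assumes "compact K" "closed K" "K \<noteq> {}"
  obtains f where "f \<in> K"
    "\<And>g h u. \<lbrakk>g \<in> K; h \<in> K; 0 < u; u < 1; f = (\<lambda>i. u * g i + (1 - u) * h i)\<rbrakk> \<Longrightarrow> g = f"
proof -
  define face where "face G \<longleftrightarrow> closed G \<and> G \<subseteq> K \<and> G \<noteq> {} \<and>
    (\<forall>g\<in>K. \<forall>h\<in>K. \<forall>u. 0 < u \<longrightarrow> u < 1 \<longrightarrow> (\<lambda>i. u * g i + (1 - u) * h i) \<in> G \<longrightarrow> g \<in> G \<and> h \<in> G)"
    for G
  have "face K"
    using assms by (auto simp: face_def)
  \<comment> \<open>Zorn's lemma is available for maximal sets, so it is applied to complements: a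
    maximal complement is a minimal face.\<close>
  have "\<exists>M\<in>uminus ` Collect face. \<forall>X\<in>uminus ` Collect face. M \<subseteq> X \<longrightarrow> X = M"
  proof (rule subset_Zorn_nonempty)
    show "uminus ` Collect face \<noteq> {}" using \<open>face K\<close> by auto
    fix C assume "C \<noteq> {}" and C: "subset.chain (uminus ` Collect face) C"
    define D where "D = uminus ` C"
    have D: "D \<noteq> {}" "\<And>G. G \<in> D \<Longrightarrow> face G" "\<And>G H. \<lbrakk>G \<in> D; H \<in> D\<rbrakk> \<Longrightarrow> G \<subseteq> H \<or> H \<subseteq> G"
      using C \<open>C \<noteq> {}\<close> by (auto simp: D_def subset.chain_def)
    \<comment> \<open>A finite intersection of members of a chain is one of them, hence nonempty;
      compactness of \<open>K\<close> carries this over to the whole chain.\<close>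
    have fin: "\<Inter>D' \<in> D" if "finite D'" "D' \<noteq> {}" "D' \<subseteq> D" for D'
      using that
    proof (induction rule: finite_ne_induct)
      case (insert G D')
      then have GD: "G \<in> D" "\<Inter>D' \<in> D" by auto
      from D(3)[OF this] have "G \<inter> \<Inter>D' = G \<or> G \<inter> \<Inter>D' = \<Inter>D'" by blast
      then show ?case using GD by (metis Inter_insert)
    qed auto
    have "K \<inter> \<Inter>D \<noteq> {}"
    proof (rule compact_imp_fip[OF \<open>compact K\<close>])
      fix D' assume "finite D'" "D' \<subseteq> D"
      show "K \<inter> \<Inter>D' \<noteq> {}"
      proof (cases "D' = {}")
        case False
        have "face (\<Inter>D')" by (intro D(2) fin) fact+
        then have "\<Inter>D' \<subseteq> K" "\<Inter>D' \<noteq> {}" by (simp_all add: face_def)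
        then show ?thesis by blast
      qed (simp add: \<open>K \<noteq> {}\<close>)
    next
      show "closed T" if "T \<in> D" for T using D(2)[OF that] by (simp add: face_def)
    qed
    moreover obtain G where "G \<in> D" using D(1) by blast
    moreover have sub: "closed G" "G \<subseteq> K" if "G \<in> D" for G
      using D(2)[OF that] by (simp_all add: face_def)
    moreover have "g \<in> G \<and> h \<in> G" if "G \<in> D" "g \<in> K" "h \<in> K" "0 < u" "u < 1"
      "(\<lambda>i. u * g i + (1 - u) * h i) \<in> \<Inter>D" for G g h u
      using D(2)[OF that(1)] that unfolding face_def by (meson InterD)
    ultimately have "face (\<Inter>D)"
      unfolding face_def by (intro conjI ballI allI impI closed_Inter) blast+
    moreover have "\<Union>C = - \<Inter>D" by (auto simp: D_def)
    ultimately show "\<Union>C \<in> uminus ` Collect face" by blast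
  qed
  then obtain G where G: "face G" and min: "\<And>H. \<lbrakk>face H; H \<subseteq> G\<rbrakk> \<Longrightarrow> H = G"
    unfolding bex_simps ball_simps by (metis (no_types, lifting) Compl_subset_Compl_iff double_complement mem_Collect_eq)
  then obtain f where f: "f \<in> G" by (auto simp: face_def)
  have single: "g = f" if g: "g \<in> G" for g
  proof
    fix i
    have comp: "compact G"
      using compact_Int_closed[OF \<open>compact K\<close>, of G] G by (auto simp: face_def Int_absorb1)
    have cont: "continuous_on S (\<lambda>f. f i)" for S :: "('i \<Rightarrow> real) set"
      by (rule continuous_on_subset[OF continuous_on_product_coordinates]) simp
    obtain m where m: "m \<in> G" "\<And>h. h \<in> G \<Longrightarrow> h i \<le> m i"
      using continuous_attains_sup[OF comp _ cont] f by blast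
    \<comment> \<open>\<open>H\<close> collects the points of \<open>G\<close> at which coordinate
      \<open>i\<close> attains its maximum \<open>m i\<close>.\<close>
    define H where "H = G \<inter> {h. h i = m i}"
    have "face H"
      unfolding face_def
    proof (intro conjI ballI allI impI)
      show "closed H"
        unfolding H_def using G by (intro closed_Int closed_Collect_eq cont) (auto simp: face_def)
      show "H \<subseteq> K" "H \<noteq> {}" using G m by (auto simp: H_def face_def)
      fix g h u assume gh: "g \<in> K" "h \<in> K" and u: "0 < u" "u < (1::real)"
        and in_H: "(\<lambda>i. u * g i + (1 - u) * h i) \<in> H"
      then have "g \<in> G" "h \<in> G" using G by (auto simp: H_def face_def)
      then have "g i \<le> m i" "h i \<le> m i" using m by auto
      moreover have "u * g i + (1 - u) * h i = m i" using in_H by (simp add: H_def)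
      \<comment> \<open>Both summands are nonnegative, so a convex combination reaches the maximum
        only if both of its ends do.\<close>
      then have "u * (m i - g i) + (1 - u) * (m i - h i) = 0" by (simp add: algebra_simps)
      ultimately have "u * (m i - g i) = 0 \<and> (1 - u) * (m i - h i) = 0"
        using u by (subst add_nonneg_eq_0_iff[symmetric]) auto
      then show "g \<in> H" "h \<in> H"
        using u \<open>g \<in> G\<close> \<open>h \<in> G\<close> by (auto simp: H_def)
    qed
    then have "H = G" by (rule min) (auto simp: H_def)
    then have "g i = m i" "f i = m i" using g f unfolding H_def by blast+
    then show "g i = f i" by simp
  qed
  show ?thesis
  proof
    show "f \<in> K" using f G by (auto simp: face_def)
    show "g = f" if "g \<in> K" "h \<in> K" "0 < u" "u < 1" "f = (\<lambda>i. u * g i + (1 - u) * h i)" for g h u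
      using that f G single unfolding face_def by blast
  qed
qed

text \<open>Banach--Alaoglu enters through Tychonoff: the dual unit ball is a closed subset of
  the product of the intervals \<open>{-norm x..norm x}\<close>.\<close>

lemma blinfun_ball_extreme_point:
  obtains \<phi> :: "'x::real_normed_vector \<Rightarrow>\<^sub>L real" where "norm \<phi> \<le> 1"
    "\<And>\<psi> \<psi>' u. \<lbrakk>norm \<psi> \<le> 1; norm \<psi>' \<le> 1; 0 < u; u < 1; \<phi> = u *\<^sub>R \<psi> + (1 - u) *\<^sub>R \<psi>'\<rbrakk> \<Longrightarrow> \<psi> = \<phi>"
proof -
  define K where "K = {f :: 'x \<Rightarrow> real. (\<forall>x. \<bar>f x\<bar> \<le> norm x) \<and>
    (\<forall>x y. f (x + y) = f x + f y) \<and> (\<forall>c x. f (c *\<^sub>R x) = c * f x)}"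
  have K: "K = blinfun_apply ` {\<psi>. norm \<psi> \<le> 1}"
  proof (intro set_eqI iffI)
    fix f assume f: "f \<in> K"
    then have "bounded_linear f"
      by (intro bounded_linear_intro[where K = 1]) (auto simp: K_def)
    moreover from this have "norm (Blinfun f) \<le> 1"
      using f by (intro norm_blinfun_bound) (simp_all add: K_def bounded_linear_Blinfun_apply)
    ultimately show "f \<in> blinfun_apply ` {\<psi>. norm \<psi> \<le> 1}"
      by (intro image_eqI[of _ _ "Blinfun f"]) (auto simp: bounded_linear_Blinfun_apply)
  next
    fix f :: "'x \<Rightarrow> real" assume "f \<in> blinfun_apply ` {\<psi>. norm \<psi> \<le> 1}"
    then obtain \<psi> where \<psi>: "norm \<psi> \<le> 1" "f = blinfun_apply \<psi>" by auto
    have "\<bar>blinfun_apply \<psi> x\<bar> \<le> norm x" for x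
      using norm_blinfun[of \<psi> x] mult_right_mono[OF \<psi>(1), of "norm x"] by simp
    then show "f \<in> K"
      using \<psi>(2) by (simp add: K_def blinfun.bilinear_simps)
  qed
  have cont: "continuous_on UNIV (\<lambda>f :: 'x \<Rightarrow> real. f x)" for x
    by (rule continuous_on_product_coordinates)
  \<comment> \<open>The ball splits into the norm bounds \<open>P\<close>, a compact box, and
    linearity \<open>L\<close>, which is closed because evaluations are continuous in the product
    topology.\<close>
  define P where "P = PiE UNIV (\<lambda>x :: 'x. {- norm x..norm x})"
  define L where "L = {f :: 'x \<Rightarrow> real. (\<forall>x y. f (x + y) = f x + f y) \<and> (\<forall>c x. f (c *\<^sub>R x) = c * f x)}"
  have "closed L"
    unfolding L_def
    by (intro closed_Collect_conj closed_Collect_all closed_Collect_eq continuous_intros cont)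
  have "compact P"
    unfolding P_def using compactin_PiE[of "\<lambda>_::'x. euclideanreal" UNIV]
    by (simp add: euclidean_product_topology)
  have "P = {f. \<forall>x. - norm x \<le> f x \<and> f x \<le> norm x}"
    by (auto simp: P_def PiE_def Pi_def)
  moreover have "closed {f :: 'x \<Rightarrow> real. \<forall>x. - norm x \<le> f x \<and> f x \<le> norm x}"
    by (intro closed_Collect_conj closed_Collect_all closed_Collect_le continuous_intros cont)
  ultimately have "closed P" by simp
  have "K = P \<inter> L"
    unfolding K_def L_def P_def PiE_def Pi_def abs_le_iff by (auto simp: minus_le_iff)
  then have cpt: "compact K" and cl: "closed K"
    using \<open>compact P\<close> \<open>closed P\<close> \<open>closed L\<close> by (simp_all add: compact_Int_closed closed_Int)
  have "(\<lambda>_. 0) \<in> K" by (simp add: K_def)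
  then have "K \<noteq> {}" by blast
  obtain f where f: "f \<in> K" and ext:
    "\<And>g h u. \<lbrakk>g \<in> K; h \<in> K; 0 < u; u < 1; f = (\<lambda>i. u * g i + (1 - u) * h i)\<rbrakk> \<Longrightarrow> g = f"
    using compact_extreme_point[OF cpt cl \<open>K \<noteq> {}\<close>] by blast
  from f obtain \<phi> where \<phi>: "norm \<phi> \<le> 1" "f = blinfun_apply \<phi>" by (auto simp: K)
  show ?thesis
  proof
    show "\<psi> = \<phi>" if "norm \<psi> \<le> 1" "norm \<psi>' \<le> 1" "0 < u" "u < 1" "\<phi> = u *\<^sub>R \<psi> + (1 - u) *\<^sub>R \<psi>'" for \<psi> \<psi>' u
    proof -
      have "blinfun_apply \<psi> = f"
        using that by (intro ext[of _ "blinfun_apply \<psi>'" u])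
          (simp_all add: K \<phi>(2) imageI fun_eq_iff blinfun.bilinear_simps)
      then show ?thesis using \<phi>(2) by (simp add: blinfun_apply_inject)
    qed
  qed (rule \<phi>(1))
qed

subsection \<open>Normed spaces with an explicit carrier\<close>

lemma (in real_nspace) neg_closed: "x \<in> ns_carrier V \<Longrightarrow> ns_scale V (-1) x \<in> ns_carrier V"
  by (rule scale_closed)

lemma (in real_nspace) add_neg:
  assumes "x \<in> ns_carrier V"
  shows "ns_add V x (ns_scale V (-1) x) = ns_zero V"
  using scale_add_left[OF assms, of 1 "-1"] assms by (simp add: scale_one scale_zero)

lemma (in real_nspace) diff_zero_imp_eq:
  assumes "x \<in> ns_carrier V" "y \<in> ns_carrier V" "ns_add V x (ns_scale V (-1) y) = ns_zero V"
  shows "x = y"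
  using assms by (metis add_assoc add_commute add_zero add_neg scale_closed zero_closed)

lemma (in real_nspace) add_add_swap:
  assumes "a \<in> ns_carrier V" "b \<in> ns_carrier V" "c \<in> ns_carrier V" "d \<in> ns_carrier V"
  shows "ns_add V (ns_add V a b) (ns_add V c d) = ns_add V (ns_add V a c) (ns_add V b d)"
  using assms by (smt (verit) add_assoc add_closed add_commute)

text \<open>If \<open>x = e + n\<close> lies outside \<open>E\<close>, then \<open>n\<close> is
  nonzero, and each \<open>y\<close> in \<open>E\<close> has distance
  \<open>norm (e - y) + norm n\<close> from \<open>x\<close>. So the ball of radius
  \<open>norm n\<close> around \<open>x\<close> misses \<open>E\<close>.\<close>

lemma (in real_nspace) l1_summand_closed:
  assumes E: "linear_subspace V E" and N: "linear_subspace V N"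
    and span: "\<And>x. x \<in> ns_carrier V \<Longrightarrow> \<exists>e\<in>E. \<exists>n\<in>N. x = ns_add V e n"
    and norm: "\<And>e n. \<lbrakk>e \<in> E; n \<in> N\<rbrakk> \<Longrightarrow> ns_norm V (ns_add V e n) = ns_norm V e + ns_norm V n"
  shows "closed_subspace V E"
proof -
  interpret Metric_space "ns_carrier V" "ns_dist V" by (rule Metric_space_ns_dist)
  have EV: "E \<subseteq> ns_carrier V" and NV: "N \<subseteq> ns_carrier V"
    using E N by (auto simp: linear_subspace_def)
  have "\<exists>r>0. disjnt E (mball x r)" if x: "x \<in> ns_carrier V - E" for x
  proof -
    obtain e n where en: "e \<in> E" "n \<in> N" "x = ns_add V e n" using span x by blast
    then have in_V: "e \<in> ns_carrier V" "n \<in> ns_carrier V" using EV NV by auto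
    have "n \<noteq> ns_zero V" using en x in_V by (auto simp: add_zero)
    then have pos: "0 < ns_norm V n"
      using norm_nonneg[of n] norm_eq_0[of n] in_V by force
    have "ns_norm V n \<le> ns_dist V x y" if y: "y \<in> E" for y
    proof -
      have yV: "y \<in> ns_carrier V" using y EV by blast
      have d: "ns_add V e (ns_scale V (-1) y) \<in> E"
        using E en y by (auto simp: linear_subspace_def)
      have "ns_add V x (ns_scale V (-1) y) = ns_add V (ns_add V e (ns_scale V (-1) y)) n"
        using in_V neg_closed[OF yV] en(3) by (metis add_assoc add_commute)
      then have "ns_dist V x y = ns_norm V (ns_add V e (ns_scale V (-1) y)) + ns_norm V n"
        using norm[OF d en(2)] x yV by (simp add: ns_dist_def)
      moreover have "0 \<le> ns_norm V (ns_add V e (ns_scale V (-1) y))"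
        using d EV by (intro norm_nonneg) auto
      ultimately show ?thesis by simp
    qed
    then have "disjnt E (mball x (ns_norm V n))" by (fastforce simp: disjnt_iff)
    with pos show ?thesis by blast
  qed
  then have "closedin mtopology E" using EV by (auto simp: closedin_metric)
  with E show ?thesis by (simp add: closed_subspace_def ns_topology_def)
qed

text \<open>Additivity of the norm yields both closedness and uniqueness: the difference of two
  decompositions of one vector has norm zero, which forces both of its components to vanish.\<close>

lemma (in real_nspace) l1_direct_sumI:
  assumes E: "linear_subspace V E" and N: "linear_subspace V N"
    and span: "\<And>x. x \<in> ns_carrier V \<Longrightarrow> \<exists>e\<in>E. \<exists>n\<in>N. x = ns_add V e n"
    and norm: "\<And>e n. \<lbrakk>e \<in> E; n \<in> N\<rbrakk> \<Longrightarrow> ns_norm V (ns_add V e n) = ns_norm V e + ns_norm V n"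
  shows "l1_direct_sum V E N"
  unfolding l1_direct_sum_def
proof (intro conjI)
  have EV: "E \<subseteq> ns_carrier V" and NV: "N \<subseteq> ns_carrier V"
    using E N by (auto simp: linear_subspace_def)
  show "closed_subspace V E" by (rule l1_summand_closed[OF E N span norm])
  show "closed_subspace V N"
  proof (rule l1_summand_closed[OF N E])
    show "\<exists>n\<in>N. \<exists>e\<in>E. x = ns_add V n e" if "x \<in> ns_carrier V" for x
      using span[OF that] EV NV add_commute by (metis subsetD)
    show "ns_norm V (ns_add V n e) = ns_norm V n + ns_norm V e" if "n \<in> N" "e \<in> E" for n e
      using norm[OF that(2,1)] add_commute[of n e] subsetD[OF NV that(1)] subsetD[OF EV that(2)] by simp
  qed
  show "\<forall>e\<in>E. \<forall>n\<in>N. ns_norm V (ns_add V e n) = ns_norm V e + ns_norm V n" using norm by blast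
  show "bij_betw (\<lambda>(e, n). ns_add V e n) (E \<times> N) (ns_carrier V)"
    unfolding bij_betw_def
  proof (intro conjI inj_onI)
    fix p q assume "p \<in> E \<times> N" "q \<in> E \<times> N" "(case p of (e, n) \<Rightarrow> ns_add V e n) = (case q of (e, n) \<Rightarrow> ns_add V e n)"
    then obtain e n e' n' where pq: "p = (e, n)" "q = (e', n')" "e \<in> E" "n \<in> N" "e' \<in> E" "n' \<in> N"
      "ns_add V e n = ns_add V e' n'" by auto
    then have in_V: "e \<in> ns_carrier V" "n \<in> ns_carrier V" "e' \<in> ns_carrier V" "n' \<in> ns_carrier V"
      using EV NV by auto
    define d m where "d = ns_add V e (ns_scale V (-1) e')" and "m = ns_add V n (ns_scale V (-1) n')"
    have dm: "d \<in> E" "m \<in> N" using E N pq by (auto simp: linear_subspace_def d_def m_def)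
    then have dmV: "d \<in> ns_carrier V" "m \<in> ns_carrier V" using EV NV by auto
    have "ns_add V d m = ns_add V (ns_add V e n) (ns_scale V (-1) (ns_add V e' n'))"
      unfolding d_def m_def
      using in_V by (simp add: scale_add_right add_add_swap neg_closed)
    also have "\<dots> = ns_zero V"
      unfolding pq(7) using in_V by (intro add_neg add_closed) auto
    finally have "ns_norm V d + ns_norm V m = 0"
      using norm[OF dm] norm_eq_0[OF zero_closed] by simp
    then have "ns_norm V d = 0" "ns_norm V m = 0"
      using norm_nonneg[OF dmV(1)] norm_nonneg[OF dmV(2)] by linarith+
    then have "d = ns_zero V" "m = ns_zero V"
      using norm_eq_0 dmV by blast+
    then show "p = q"
      using diff_zero_imp_eq in_V pq(1,2) by (simp add: d_def m_def)
  next
    show "(\<lambda>(e, n). ns_add V e n) ` (E \<times> N) = ns_carrier V"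
      using span EV NV add_closed by (auto simp: image_iff) blast+
  qed
qed

text \<open>In coordinates, \<open>\<bar>a i + t * b i\<bar>\<close> is affine in \<open>t\<close>
  as long as \<open>t * \<bar>b i\<bar> \<le> \<bar>a i\<bar>\<close>; it is
  \<open>t * \<bar>b i\<bar>\<close> where \<open>a i = 0\<close>, and the
  \<open>N\<close>-component adds \<open>t * norm n\<close>. So the quotient is constant for small
  \<open>t\<close>, with a threshold common to the whole unit ball.\<close>

lemma (in real_nspace) SSD_point_ell1_summand:
  assumes iso: "lin_isometric (V\<lparr>ns_carrier := E\<rparr>) (ell1 k)"
    and sum: "l1_direct_sum V E N" and f: "f \<in> E"
  shows "SSD_point V f"
proof -
  have E: "linear_subspace V E" and N: "linear_subspace V N"
    and bij: "bij_betw (\<lambda>(e, n). ns_add V e n) (E \<times> N) (ns_carrier V)"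
    and norm: "\<And>e n. \<lbrakk>e \<in> E; n \<in> N\<rbrakk> \<Longrightarrow> ns_norm V (ns_add V e n) = ns_norm V e + ns_norm V n"
    using sum by (auto simp: l1_direct_sum_def closed_subspace_def)
  have EV: "E \<subseteq> ns_carrier V" and NV: "N \<subseteq> ns_carrier V"
    using E N by (auto simp: linear_subspace_def)
  obtain T where T: "\<And>x y. \<lbrakk>x \<in> E; y \<in> E\<rbrakk> \<Longrightarrow> T (ns_add V x y) = (\<lambda>i. T x i + T y i)"
    "\<And>c x. x \<in> E \<Longrightarrow> T (ns_scale V c x) = (\<lambda>i. c * T x i)"
    "\<And>x. x \<in> E \<Longrightarrow> ns_norm V x = (\<Sum>i<k. \<bar>T x i\<bar>)"
  proof -
    obtain T where "\<forall>x\<in>E. \<forall>y\<in>E. T (ns_add V x y) = (\<lambda>i. T x i + T y i)"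
      "\<forall>c. \<forall>x\<in>E. T (ns_scale V c x) = (\<lambda>i. c * T x i)"
      "\<forall>x\<in>E. (\<Sum>i<k. \<bar>T x i\<bar>) = ns_norm V x"
      using iso unfolding lin_isometric_def ell1_def by auto
    then show thesis by (intro that[of T]) auto
  qed
  define a where "a = T f"
  \<comment> \<open>The threshold is the smallest nonzero \<open>\<bar>a i\<bar>\<close>, capped at
    1; the inserted 1 keeps \<open>Min\<close> defined when all coordinates vanish.\<close>
  define \<delta> where "\<delta> = Min (insert 1 ((\<lambda>i. \<bar>a i\<bar>) ` {i. i < k \<and> a i \<noteq> 0}))"
  have \<delta>: "0 < \<delta>" "\<And>i. \<lbrakk>i < k; a i \<noteq> 0\<rbrakk> \<Longrightarrow> \<delta> \<le> \<bar>a i\<bar>"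
    unfolding \<delta>_def by (auto intro!: Min_le simp: Min_gr_iff)
  define q where "q t h = (ns_norm V (ns_add V f (ns_scale V t h)) - ns_norm V f) / t" for t h
  have const: "q t h = q \<delta> h" if h: "h \<in> ns_carrier V" "ns_norm V h \<le> 1" and t: "0 < t" "t \<le> \<delta>" for t h
  proof -
    obtain e n where en: "e \<in> E" "n \<in> N" "h = ns_add V e n"
      using bij h(1) unfolding bij_betw_def by fastforce
    then have in_V: "f \<in> ns_carrier V" "e \<in> ns_carrier V" "n \<in> ns_carrier V" using EV NV f by auto
    define b where "b = T e"
    \<comment> \<open>\<open>G\<close> is the common value of the quotients, the directional
      derivative of the norm at \<open>f\<close> along \<open>h\<close>.\<close>
    define G where "G = (\<Sum>i<k. if a i = 0 then \<bar>b i\<bar> else sgn (a i) * b i) + ns_norm V n"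
    have "ns_norm V e \<le> 1" using h(2) en norm norm_nonneg[OF in_V(3)] by fastforce
    then have b1: "\<bar>b i\<bar> \<le> 1" if "i < k" for i
      using T(3)[OF en(1)] member_le_sum[of i "{..<k}" "\<lambda>i. \<bar>b i\<bar>"] that by (auto simp: b_def)
    have "q s h = G" if s: "0 < s" "s \<le> \<delta>" for s
    proof -
      have "ns_add V f (ns_scale V s h) = ns_add V (ns_add V f (ns_scale V s e)) (ns_scale V s n)"
        using in_V by (simp add: en(3) scale_add_right add_assoc scale_closed)
      moreover have "ns_add V f (ns_scale V s e) \<in> E" "ns_scale V s n \<in> N" "ns_scale V s e \<in> E"
        using E N f en by (auto simp: linear_subspace_def)
      ultimately have "ns_norm V (ns_add V f (ns_scale V s h)) = (\<Sum>i<k. \<bar>a i + s * b i\<bar>) + s * ns_norm V n"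
        using norm T f en in_V s by (simp add: norm_scale a_def b_def)
      also have "(\<Sum>i<k. \<bar>a i + s * b i\<bar>) = (\<Sum>i<k. \<bar>a i\<bar> + s * (if a i = 0 then \<bar>b i\<bar> else sgn (a i) * b i))"
      proof (rule sum.cong)
        fix i assume "i \<in> {..<k}"
        then have i: "i < k" by simp
        show "\<bar>a i + s * b i\<bar> = \<bar>a i\<bar> + s * (if a i = 0 then \<bar>b i\<bar> else sgn (a i) * b i)"
        proof (cases "a i = 0")
          case False
          have "s * \<bar>b i\<bar> \<le> \<delta> * 1" using s b1[OF i] by (intro mult_mono) auto
          then have "\<bar>s * b i\<bar> \<le> \<bar>a i\<bar>" using \<delta>(2)[OF i False] s by (simp add: abs_mult)
          then show ?thesis using False by (auto simp: sgn_if abs_if split: if_splits)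
        qed (use s in \<open>simp add: abs_mult\<close>)
      qed simp
      finally show "q s h = G"
        using s f T(3) by (simp add: q_def G_def a_def sum.distrib sum_distrib_left[symmetric] field_simps)
    qed
    from this[of t] this[of \<delta>] t \<delta>(1) show ?thesis by simp
  qed
  have "uniform_limit {h \<in> ns_carrier V. ns_norm V h \<le> 1} q (q \<delta>) (at_right 0)"
    unfolding uniform_limit_iff
  proof (intro allI impI)
    fix \<epsilon> :: real assume "0 < \<epsilon>"
    have "dist (q t h) (q \<delta> h) < \<epsilon>"
      if "0 < t" "t < \<delta>" "h \<in> {h \<in> ns_carrier V. ns_norm V h \<le> 1}" for t h
      using const[of h t] that \<open>0 < \<epsilon>\<close> by simp
    then show "\<forall>\<^sub>F t in at_right 0. \<forall>h\<in>{h \<in> ns_carrier V. ns_norm V h \<le> 1}. dist (q t h) (q \<delta> h) < \<epsilon>"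
      unfolding eventually_at_right_field using \<delta>(1) by blast
  qed
  then show ?thesis
    unfolding SSD_point_def q_def[abs_def] using f EV by blast
qed

text \<open>Summands are parametrised by coordinate vectors, whereas \<open>lin_isometric\<close>
  wants a map out of the subspace. A linear norm-preserving map is injective, so its inverse on the
  range serves.\<close>

lemma lin_isometric_range:
  assumes W: "real_nspace W" and V: "real_nspace V"
    and closed: "\<And>a. a \<in> ns_carrier W \<Longrightarrow> S a \<in> ns_carrier V"
    and add: "\<And>a b. \<lbrakk>a \<in> ns_carrier W; b \<in> ns_carrier W\<rbrakk> \<Longrightarrow> S (ns_add W a b) = ns_add V (S a) (S b)"
    and scale: "\<And>c a. a \<in> ns_carrier W \<Longrightarrow> S (ns_scale W c a) = ns_scale V c (S a)"
    and norm: "\<And>a. a \<in> ns_carrier W \<Longrightarrow> ns_norm V (S a) = ns_norm W a"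
  shows "linear_subspace V (S ` ns_carrier W)"
    and "lin_isometric (V\<lparr>ns_carrier := S ` ns_carrier W\<rparr>) W"
proof -
  interpret V: real_nspace V by (rule V)
  interpret W: real_nspace W by (rule W)
  have "S (ns_zero W) = ns_zero V"
    using norm[OF W.zero_closed] V.norm_eq_0 W.norm_eq_0 W.zero_closed closed by metis
  then have "ns_zero V \<in> S ` ns_carrier W" using W.zero_closed by (metis imageI)
  moreover have "ns_add V x y \<in> S ` ns_carrier W" if "x \<in> S ` ns_carrier W" "y \<in> S ` ns_carrier W" for x y
    using that by (auto simp: add[symmetric] W.add_closed)
  moreover have "ns_scale V c x \<in> S ` ns_carrier W" if "x \<in> S ` ns_carrier W" for x c
    using that by (auto simp: scale[symmetric] W.scale_closed)
  ultimately show "linear_subspace V (S ` ns_carrier W)"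
    using closed by (auto simp: linear_subspace_def)
  have inj: "inj_on S (ns_carrier W)"
  proof (rule inj_onI)
    fix a b assume ab: "a \<in> ns_carrier W" "b \<in> ns_carrier W" "S a = S b"
    let ?d = "ns_add W a (ns_scale W (-1) b)"
    have d: "?d \<in> ns_carrier W" using ab by (simp add: W.add_closed W.scale_closed)
    have "S ?d = ns_zero V"
      using ab closed[OF ab(2)] by (simp add: add scale W.scale_closed V.add_neg)
    then have "ns_norm W ?d = 0" using norm[OF d] V.norm_eq_0[OF V.zero_closed] by simp
    then show "a = b" using W.diff_zero_imp_eq ab W.norm_eq_0[OF d] by blast
  qed
  then show "lin_isometric (V\<lparr>ns_carrier := S ` ns_carrier W\<rparr>) W"
    unfolding lin_isometric_def
    by (intro exI[of _ "inv_into (ns_carrier W) S"])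
      (auto simp: add[symmetric] scale[symmetric] norm W.add_closed W.scale_closed
        intro: bij_betw_inv_into inj_on_imp_bij_betw)
qed

lemma real_nspace_ell1: "real_nspace (ell1 k)"
proof
  fix a assume "a \<in> ns_carrier (ell1 k)"
  then show "ns_norm (ell1 k) a = 0 \<longleftrightarrow> a = ns_zero (ell1 k)"
    by (auto simp: ell1_def sum_nonneg_eq_0_iff fun_eq_iff) (metis lessThan_iff not_less)
next
  fix a b
  show "ns_norm (ell1 k) (ns_add (ell1 k) a b) \<le> ns_norm (ell1 k) a + ns_norm (ell1 k) b"
    by (simp add: ell1_def sum.distrib[symmetric] sum_mono)
qed (auto simp: ell1_def algebra_simps sum_nonneg sum_distrib_left abs_mult)

subsection \<open>Atoms\<close>

definition atom :: "'a measure \<Rightarrow> 'a set \<Rightarrow> bool" where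
  "atom M A \<longleftrightarrow> A \<in> sets M \<and> A \<notin> null_sets M \<and>
    (\<forall>B\<in>sets M. B \<subseteq> A \<longrightarrow> B \<in> null_sets M \<or> A - B \<in> null_sets M)"

text \<open>Sizes are measured by \<open>\<integral>\<^sub>A \<bar>g\<bar>\<close> instead of \<open>\<mu>(A)\<close>, so finiteness of the
  measure of an atom is never needed.\<close>

definition mass :: "'a measure \<Rightarrow> ('a \<Rightarrow> real) \<Rightarrow> 'a set \<Rightarrow> real" where
  "mass M g A = (\<integral>x. indicator A x * \<bar>g x\<bar> \<partial>M)"

text \<open>The uniform lower bound limits how often the support can be split: disjoint non-null
  pieces each use up at least \<open>\<epsilon>\<close> of the finite integral of
  \<open>\<bar>g\<bar>\<close>. Zero functions qualify vacuously.\<close>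

definition atomic_support :: "'a measure \<Rightarrow> ('a \<Rightarrow> real) \<Rightarrow> bool" where
  "atomic_support M g \<longleftrightarrow> integrable M g \<and>
    (\<exists>\<epsilon>>0. \<forall>A\<in>sets M - null_sets M. A \<subseteq> {x. g x \<noteq> 0} \<longrightarrow> \<epsilon> \<le> mass M g A)"

lemma integrable_indicator_mult [simp]:
  fixes f :: "'a \<Rightarrow> real"
  assumes "integrable M f" "A \<in> sets M"
  shows "integrable M (\<lambda>x. indicator A x * f x)"
  using integrable_mult_indicator[OF assms(2,1)] by simp

lemma mass_nonneg: "0 \<le> mass M g A"
  by (simp add: mass_def)

lemma mass_Un:
  assumes "integrable M g" "A \<in> sets M" "B \<in> sets M" "A \<inter> B = {}"
  shows "mass M g (A \<union> B) = mass M g A + mass M g B"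
proof -
  have "indicator (A \<union> B) x * \<bar>g x\<bar> = indicator A x * \<bar>g x\<bar> + indicator B x * \<bar>g x\<bar>" for x
    using assms(4) by (auto simp: indicator_def)
  then show ?thesis using assms by (simp add: mass_def)
qed

lemma mass_mono:
  assumes "integrable M g" "integrable M h" "A \<in> sets M" "B \<in> sets M" "A \<subseteq> B"
    "\<And>x. x \<in> A \<Longrightarrow> \<bar>g x\<bar> \<le> \<bar>h x\<bar>"
  shows "mass M g A \<le> mass M h B"
  unfolding mass_def
proof (rule integral_mono)
  show "indicator A x * \<bar>g x\<bar> \<le> indicator B x * \<bar>h x\<bar>" for x
    using assms(5,6) by (auto simp: indicator_def)
qed (use assms(1-4) in simp_all)

lemma mass_pos:
  assumes "integrable M g" "A \<in> sets M - null_sets M" "A \<subseteq> {x. g x \<noteq> 0}"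
  shows "0 < mass M g A"
proof (rule ccontr)
  assume "\<not> 0 < mass M g A"
  then have "mass M g A = 0" using mass_nonneg[of M g A] by simp
  then have "AE x in M. indicator A x * \<bar>g x\<bar> = 0"
    unfolding mass_def using assms by (subst integral_nonneg_eq_0_iff_AE[symmetric]) auto
  then have "AE x in M. x \<notin> A" by eventually_elim (use assms(3) in auto)
  then show False using assms(2) AE_iff_null_sets[of A M] by simp
qed

text \<open>Absolute values prevent cancellation, so the new support is the union of the two. A
  non-null part of it meets the support of \<open>f\<close> in a non-null set or leaves a non-null
  remainder in that of \<open>g\<close>.\<close>

lemma atomic_support_add:
  assumes "atomic_support M f" "atomic_support M g"
  shows "atomic_support M (\<lambda>x. \<bar>f x\<bar> + \<bar>g x\<bar>)"
proof -
  let ?h = "\<lambda>x. \<bar>f x\<bar> + \<bar>g x\<bar>"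
  have int: "integrable M f" "integrable M g" using assms by (simp_all add: atomic_support_def)
  obtain \<epsilon>1 where "0 < \<epsilon>1"
    and f: "\<And>A. \<lbrakk>A \<in> sets M - null_sets M; A \<subseteq> {x. f x \<noteq> 0}\<rbrakk> \<Longrightarrow> \<epsilon>1 \<le> mass M f A"
    using assms(1) unfolding atomic_support_def by blast
  obtain \<epsilon>2 where "0 < \<epsilon>2"
    and g: "\<And>A. \<lbrakk>A \<in> sets M - null_sets M; A \<subseteq> {x. g x \<noteq> 0}\<rbrakk> \<Longrightarrow> \<epsilon>2 \<le> mass M g A"
    using assms(2) unfolding atomic_support_def by blast
  have "min \<epsilon>1 \<epsilon>2 \<le> mass M ?h A" if A: "A \<in> sets M - null_sets M" "A \<subseteq> {x. ?h x \<noteq> 0}" for A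
  proof -
    have Am: "A \<in> sets M" "A \<subseteq> space M" using A sets.sets_into_space by auto
    have fm: "f \<in> borel_measurable M" using int by auto
    define B where "B = {x \<in> A. f x \<noteq> 0}"
    have "B = A \<inter> {x \<in> space M. f x \<noteq> 0}" using Am by (auto simp: B_def)
    then have B: "B \<in> sets M" using Am fm by simp
    have "B \<notin> null_sets M \<or> A - B \<notin> null_sets M"
    proof (rule ccontr)
      assume "\<not> ?thesis"
      then have "B \<union> (A - B) \<in> null_sets M" by (intro null_sets.Un) auto
      moreover have "B \<union> (A - B) = A" by (auto simp: B_def)
      ultimately show False using A(1) by simp
    qed
    then show ?thesis
    proof
      assume "B \<notin> null_sets M"
      then have "\<epsilon>1 \<le> mass M f B" using B by (intro f) (auto simp: B_def)
      also have "\<dots> \<le> mass M ?h A" using int B Am by (intro mass_mono) (auto simp: B_def)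
      finally show ?thesis by simp
    next
      assume "A - B \<notin> null_sets M"
      then have "\<epsilon>2 \<le> mass M g (A - B)" using A B by (intro g) (auto simp: B_def)
      also have "\<dots> \<le> mass M ?h A" using int B Am by (intro mass_mono) auto
      finally show ?thesis by simp
    qed
  qed
  moreover have "0 < min \<epsilon>1 \<epsilon>2" using \<open>0 < \<epsilon>1\<close> \<open>0 < \<epsilon>2\<close> by simp
  moreover have "integrable M ?h" using int by simp
  ultimately show ?thesis unfolding atomic_support_def by blast
qed

lemma atomic_support_sum:
  assumes "finite S" "\<And>s. s \<in> S \<Longrightarrow> atomic_support M (f s)"
  shows "atomic_support M (\<lambda>x. \<Sum>s\<in>S. \<bar>f s x\<bar>)"
  using assms
proof (induction rule: finite_induct)
  case empty
  \<comment> \<open>The support is empty and has no non-null subset, so any positive bound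
    works.\<close>
  show ?case unfolding atomic_support_def by (intro conjI exI[of _ 1]) auto
next
  case (insert s S)
  then show ?case
    using atomic_support_add[of M "f s" "\<lambda>x. \<Sum>s\<in>S. \<bar>f s x\<bar>"] by (simp add: sum_nonneg)
qed

text \<open>A set that is neither null nor an atom splits into two non-null pieces. Each has mass at
  least \<open>\<epsilon>\<close>, so the mass of the other drops by that amount and induction on
  \<open>n\<close> applies to both.\<close>

lemma atom_decomposition:
  assumes g: "integrable M g" and "0 < \<epsilon>"
    and "\<And>A. \<lbrakk>A \<in> sets M - null_sets M; A \<subseteq> U\<rbrakk> \<Longrightarrow> \<epsilon> \<le> mass M g A"
    and "U \<in> sets M" "mass M g U < real n * \<epsilon>"
  shows "\<exists>\<A>. finite \<A> \<and> disjoint \<A> \<and> (\<forall>A\<in>\<A>. atom M A) \<and> \<Union>\<A> \<subseteq> U \<and> U - \<Union>\<A> \<in> null_sets M"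
  using assms(3-)
proof (induction n arbitrary: U)
  case 0
  then show ?case using mass_nonneg[of M g U] by simp
next
  case (Suc n)
  consider "U \<in> null_sets M" | "atom M U"
    | B where "B \<in> sets M" "B \<subseteq> U" "B \<notin> null_sets M" "U - B \<notin> null_sets M"
    using Suc.prems(2) unfolding atom_def by blast
  then show ?case
  proof cases
    case 1
    then show ?thesis by (intro exI[of _ "{}"]) auto
  next
    case 2
    then show ?thesis by (intro exI[of _ "{U}"]) auto
  next
    case 3
    let ?C = "U - B"
    have sets: "B \<in> sets M" "?C \<in> sets M" using 3 Suc.prems(2) by auto
    have "B \<union> ?C = U" using 3 by auto
    then have "mass M g U = mass M g B + mass M g ?C"
      using mass_Un[OF g sets] by auto
    moreover have "\<epsilon> \<le> mass M g B" "\<epsilon> \<le> mass M g ?C"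
      using 3 sets by (auto intro!: Suc.prems(1))
    ultimately have less: "mass M g B < real n * \<epsilon>" "mass M g ?C < real n * \<epsilon>"
      using Suc.prems(3) by (auto simp: algebra_simps)
    obtain \<A> where A: "finite \<A>" "disjoint \<A>" "\<forall>A\<in>\<A>. atom M A" "\<Union>\<A> \<subseteq> B" "B - \<Union>\<A> \<in> null_sets M"
      using Suc.IH[OF _ sets(1) less(1)] Suc.prems(1) 3(2) by (meson order_trans)
    obtain \<A>' where A': "finite \<A>'" "disjoint \<A>'" "\<forall>A\<in>\<A>'. atom M A" "\<Union>\<A>' \<subseteq> ?C" "?C - \<Union>\<A>' \<in> null_sets M"
      using Suc.IH[OF _ sets(2) less(2)] Suc.prems(1) by (meson Diff_subset order_trans)
    have "U - \<Union>(\<A> \<union> \<A>') = (B - \<Union>\<A>) \<union> (?C - \<Union>\<A>')" using 3(2) A(4) A'(4) by auto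
    then have "U - \<Union>(\<A> \<union> \<A>') \<in> null_sets M" using A(5) A'(5) by (metis null_sets.Un)
    moreover have "disjoint (\<A> \<union> \<A>')"
      using A(2,4) A'(2,4) by (intro disjoint_union) auto
    moreover have "\<Union>(\<A> \<union> \<A>') \<subseteq> U" using A(4) A'(4) 3(2) by auto
    ultimately show ?thesis
      using A(1,3) A'(1,3) by (intro exI[of _ "\<A> \<union> \<A>'"]) auto
  qed
qed

text \<open>Within an atom the set where \<open>h > 0\<close> is null or almost everything. In the
  second case the vanishing integral forces \<open>h = 0\<close> almost everywhere on
  \<open>A\<close>, which makes \<open>A\<close> null and the claim vacuous.\<close>

lemma atom_AE_le_0:
  fixes h :: "'a \<Rightarrow> real"
  assumes A: "atom M A" and h: "integrable M h" and int: "(\<integral>x. indicator A x * h x \<partial>M) = 0"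
  shows "AE x in M. x \<in> A \<longrightarrow> h x \<le> 0"
proof -
  have Am: "A \<in> sets M" "A \<subseteq> space M" using A sets.sets_into_space by (auto simp: atom_def)
  define B where "B = {x \<in> A. 0 < h x}"
  have "B = A \<inter> {x \<in> space M. 0 < h x}" using Am by (auto simp: B_def)
  then have B: "B \<in> sets M" using Am h by simp
  consider "B \<in> null_sets M" | "A - B \<in> null_sets M"
    using A B by (auto simp: atom_def B_def)
  then show ?thesis
  proof cases
    case 1
    then have "AE x in M. x \<notin> B" by (rule AE_not_in)
    then show ?thesis by eventually_elim (auto simp: B_def not_less)
  next
    case 2
    then have ae: "AE x in M. x \<notin> A - B" by (rule AE_not_in)
    then have "AE x in M. 0 \<le> indicator A x * h x"
      by eventually_elim (auto simp: B_def indicator_def)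
    then have "AE x in M. indicator A x * h x = 0"
      using int h Am by (subst integral_nonneg_eq_0_iff_AE[symmetric]) auto
    with ae have "AE x in M. x \<notin> A"
      by eventually_elim (auto simp: B_def indicator_def)
    then show ?thesis by eventually_elim simp
  qed
qed

text \<open>The factor \<open>c\<close> is chosen so that \<open>f - c * \<bar>g\<bar>\<close> has
  integral zero over \<open>A\<close>; the sign lemma then applies to this difference and to its
  negative.\<close>

lemma atom_AE_proportional:
  assumes A: "atom M A" and g: "integrable M g" and f: "integrable M f" and supp: "A \<subseteq> {x. g x \<noteq> 0}"
  shows "AE x in M. x \<in> A \<longrightarrow> f x = (\<integral>y. indicator A y * f y \<partial>M) / mass M g A * \<bar>g x\<bar>"
proof -
  define c where "c = (\<integral>y. indicator A y * f y \<partial>M) / mass M g A"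
  define h where "h x = f x - c * \<bar>g x\<bar>" for x
  have Am: "A \<in> sets M" using A by (simp add: atom_def)
  have "0 < mass M g A" using A g supp by (intro mass_pos) (auto simp: atom_def)
  have "(\<integral>x. indicator A x * h x \<partial>M) = (\<integral>x. indicator A x * f x - c * (indicator A x * \<bar>g x\<bar>) \<partial>M)"
    by (simp add: h_def algebra_simps)
  also have "\<dots> = 0"
    using f g Am \<open>0 < mass M g A\<close> by (simp add: c_def mass_def[symmetric])
  finally have 0: "(\<integral>x. indicator A x * h x \<partial>M) = 0" .
  have h: "integrable M h" unfolding h_def using f g by auto
  have "AE x in M. x \<in> A \<longrightarrow> h x \<le> 0" by (rule atom_AE_le_0[OF A h 0])
  moreover have "AE x in M. x \<in> A \<longrightarrow> - h x \<le> 0"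
    using h 0 by (intro atom_AE_le_0[OF A]) auto
  ultimately show ?thesis unfolding c_def[symmetric] by eventually_elim (auto simp: h_def)
qed

subsection \<open>Summands of the space of integrable functions\<close>

abbreviation L1_class :: "'a measure \<Rightarrow> ('a \<Rightarrow> real) \<Rightarrow> ('a \<Rightarrow> real) set" where
  "L1_class M f \<equiv> ae_eq_rel M `` {f}"

lemma L1_class_in_carrier: "integrable M f \<Longrightarrow> L1_class M f \<in> ns_carrier (L1 M)"
  by (auto simp: L1_carrier)

text \<open>The test direction is \<open>- f\<close> restricted to \<open>A\<close> and normalised: along it the difference
  quotient is \<open>-1\<close> at \<open>t = mass M f A\<close> but nonnegative for \<open>t \<ge> 2 * mass M f A\<close>.\<close>

lemma SSD_point_imp_atomic_support:
  assumes f: "integrable M f" and ssd: "SSD_point (L1 M) (L1_class M f)"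
  shows "atomic_support M f"
proof -
  define q where "q t h = (ns_norm (L1 M) (ns_add (L1 M) (L1_class M f) (ns_scale (L1 M) t h)) -
    ns_norm (L1 M) (L1_class M f)) / t" for t h
  let ?ball = "{h \<in> ns_carrier (L1 M). ns_norm (L1 M) h \<le> 1}"
  obtain l where "uniform_limit ?ball q l (at_right 0)"
    using ssd unfolding SSD_point_def q_def[abs_def] by blast
  then have "\<forall>\<^sub>F t in at_right 0. \<forall>h\<in>?ball. dist (q t h) (l h) < 1 / 2"
    unfolding uniform_limit_iff by (rule allE[of _ "1 / 2"]) simp
  then obtain b where b: "0 < b"
    "\<And>t h. \<lbrakk>0 < t; t < b; h \<in> ?ball\<rbrakk> \<Longrightarrow> dist (q t h) (l h) < 1 / 2"
    unfolding eventually_at_right_field by blast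
  \<comment> \<open>If the mass \<open>a\<close> were below \<open>b / 4\<close>, the times
    \<open>a\<close> and \<open>b / 2\<close> would both be admissible, with
    \<open>b / 2 > 2 * a\<close>. The quotients there differ by at least 1, so they cannot both be
    within 1/2 of the same limit.\<close>
  have "b / 4 \<le> mass M f A" if A: "A \<in> sets M - null_sets M" "A \<subseteq> {x. f x \<noteq> 0}" for A
  proof (rule ccontr)
    assume less: "\<not> b / 4 \<le> mass M f A"
    define a where "a = mass M f A"
    have a: "0 < a" "a < b / 4"
      using mass_pos[OF f A] less by (simp_all add: a_def)
    have Am: "A \<in> sets M" using A by simp
    define h where "h = (\<lambda>x. - 1 / a * (indicator A x * f x))"
    have h: "integrable M h" unfolding h_def using f Am by (intro integrable_mult_right) simp
    have "\<bar>h x\<bar> = 1 / a * (indicator A x * \<bar>f x\<bar>)" for x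
      using a by (simp add: h_def abs_mult)
    then have "(\<integral>x. \<bar>h x\<bar> \<partial>M) = 1"
      using a by (simp add: mass_def[symmetric] a_def[symmetric])
    then have ball: "L1_class M h \<in> ?ball" using h by (simp add: L1_class_in_carrier L1_norm)
    have q: "q s (L1_class M h) = (\<bar>1 - s / a\<bar> * a - a) / s" if "0 < s" for s
    proof -
      have "\<bar>f x + s * h x\<bar> = \<bar>f x\<bar> + (\<bar>1 - s / a\<bar> - 1) * (indicator A x * \<bar>f x\<bar>)" for x
      proof (cases "x \<in> A")
        case True
        then have "f x + s * h x = (1 - s / a) * f x" by (simp add: h_def algebra_simps)
        then have eq: "\<bar>f x + s * h x\<bar> = \<bar>1 - s / a\<bar> * \<bar>f x\<bar>" by (simp only: abs_mult)
        show ?thesis unfolding eq using True by (simp add: algebra_simps)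
      qed (simp add: h_def)
      then have "(\<integral>x. \<bar>f x + s * h x\<bar> \<partial>M) = (\<integral>x. \<bar>f x\<bar> \<partial>M) + (\<bar>1 - s / a\<bar> - 1) * a"
        using f Am by (simp add: a_def mass_def)
      then show ?thesis
        using f h by (simp add: q_def L1_scale L1_add L1_norm algebra_simps)
    qed
    have "q a (L1_class M h) = - 1" using q[of a] a by simp
    moreover have "0 \<le> q (b / 2) (L1_class M h)"
    proof -
      have "1 \<le> b / 2 / a" using a by (simp add: field_simps)
      then have "\<bar>1 - b / 2 / a\<bar> * a - a = b / 2 - 2 * a" using a by (simp add: field_simps)
      then have "q (b / 2) (L1_class M h) = (b / 2 - 2 * a) / (b / 2)"
        using q[OF half_gt_zero[OF b(1)]] by (simp only:)
      then show ?thesis using a b(1) by simp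
    qed
    moreover have "dist (q a (L1_class M h)) (l (L1_class M h)) < 1 / 2"
      "dist (q (b / 2) (L1_class M h)) (l (L1_class M h)) < 1 / 2"
      using a b(1) by (intro b(2)[OF _ _ ball]; simp)+
    ultimately show False unfolding dist_real_def by linarith
  qed
  then show ?thesis using f b(1) unfolding atomic_support_def by (intro conjI exI[of _ "b / 4"]) auto
qed

text \<open>A function representing an extreme point of the unit ball cannot be split into two
  nonzero disjointly supported pieces.\<close>

lemma dual_L1_atomic_support:
  assumes nontrivial: "ns_carrier (L1 M) \<noteq> {ns_zero (L1 M)}"
    and dual: "is_dual_of (L1 M) TYPE('x::banach)"
  obtains f where "atomic_support M f" "\<not> (AE x in M. f x = 0)"
proof -
  interpret real_nspace "L1 M" by (rule real_nspace_L1)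
  obtain T :: "('a \<Rightarrow> real) set \<Rightarrow> 'x \<Rightarrow>\<^sub>L real" where bij: "bij_betw T (ns_carrier (L1 M)) UNIV"
    and T_add: "\<forall>x\<in>ns_carrier (L1 M). \<forall>y\<in>ns_carrier (L1 M). T (ns_add (L1 M) x y) = T x + T y"
    and T_scale: "\<forall>c. \<forall>x\<in>ns_carrier (L1 M). T (ns_scale (L1 M) c x) = c *\<^sub>R T x"
    and T_norm: "\<forall>x\<in>ns_carrier (L1 M). norm (T x) = ns_norm (L1 M) x"
    using dual unfolding is_dual_of_def lin_isometric_def type_nspace_def by auto
  obtain \<phi> :: "'x \<Rightarrow>\<^sub>L real" where \<phi>: "norm \<phi> \<le> 1" and ext:
    "\<And>\<psi> \<psi>' u. \<lbrakk>norm \<psi> \<le> 1; norm \<psi>' \<le> 1; 0 < u; u < 1; \<phi> = u *\<^sub>R \<psi> + (1 - u) *\<^sub>R \<psi>'\<rbrakk> \<Longrightarrow> \<psi> = \<phi>"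
    using blinfun_ball_extreme_point[where ?'x = 'x] by blast
  have "\<phi> \<in> T ` ns_carrier (L1 M)" using bij by (simp add: bij_betw_def)
  then obtain f where f: "integrable M f" and Tf: "T (L1_class M f) = \<phi>"
    by (auto simp: L1_carrier)
  define s where "s = (\<integral>x. \<bar>f x\<bar> \<partial>M)"
  have norm_s: "norm \<phi> = s"
    unfolding s_def L1_norm[OF f, symmetric] Tf[symmetric] using T_norm L1_class_in_carrier[OF f] by blast
  \<comment> \<open>In a nonzero space the origin is not extreme, being the midpoint of a unit
    vector and its negative.\<close>
  have "\<phi> \<noteq> 0"
  proof
    assume "\<phi> = 0"
    obtain v where v: "v \<in> ns_carrier (L1 M)" "v \<noteq> ns_zero (L1 M)"
      using nontrivial zero_closed by blast
    define \<psi> where "\<psi> = T v /\<^sub>R norm (T v)"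
    have "norm (T v) \<noteq> 0" using T_norm v norm_eq_0 by simp
    then have "norm \<psi> = 1" by (simp add: \<psi>_def)
    moreover from this have "\<psi> = \<phi>"
      by (intro ext[of \<psi> "- \<psi>" "1 / 2"]) (simp_all add: \<open>\<phi> = 0\<close>)
    ultimately show False using \<open>\<phi> = 0\<close> by simp
  qed
  then have s: "0 < s" "s \<le> 1" using norm_s \<phi> by auto
  \<comment> \<open>The bound is the full norm \<open>s\<close>: any non-null part of the support
    must carry all of the mass.\<close>
  have "s \<le> mass M f A" if A: "A \<in> sets M - null_sets M" "A \<subseteq> {x. f x \<noteq> 0}" for A
  proof (rule ccontr)
    assume less: "\<not> s \<le> mass M f A"
    define a where "a = mass M f A"
    have a: "0 < a" "a < s" "a < 1"
      using mass_pos[OF f A] less s by (simp_all add: a_def)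
    have fA: "integrable M (\<lambda>x. indicator A x * f x)" using A f by simp
    \<comment> \<open>\<open>f\<close> is the convex combination of \<open>f1\<close> and
      \<open>f2\<close> with weights \<open>a\<close> and \<open>1 - a\<close>. Here
      \<open>f1\<close> has norm 1, and \<open>f2\<close> has norm \<open>(s - a) / (1 - a)\<close>,
      at most 1 because \<open>s \<le> 1\<close>.\<close>
    define f1 where "f1 = (\<lambda>x. 1 / a * (indicator A x * f x))"
    define f2 where "f2 = (\<lambda>x. 1 / (1 - a) * (f x - indicator A x * f x))"
    have int: "integrable M f1" "integrable M f2"
      unfolding f1_def f2_def by (intro integrable_mult_right Bochner_Integration.integrable_diff f fA)+
    have "\<bar>f1 x\<bar> = 1 / a * (indicator A x * \<bar>f x\<bar>)" for x
      using a by (simp add: f1_def abs_mult)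
    then have norm1: "ns_norm (L1 M) (L1_class M f1) = 1"
      using a int by (simp add: L1_norm mass_def[symmetric] a_def[symmetric])
    have "\<bar>f2 x\<bar> = 1 / (1 - a) * (\<bar>f x\<bar> - indicator A x * \<bar>f x\<bar>)" for x
      using a by (auto simp: f2_def abs_mult indicator_def)
    then have "ns_norm (L1 M) (L1_class M f2) = (s - a) / (1 - a)"
      using A f int by (simp add: L1_norm mass_def a_def s_def)
    then have norm2: "ns_norm (L1 M) (L1_class M f2) \<le> 1" using a s by simp
    have "f = (\<lambda>x. a * f1 x + (1 - a) * f2 x)"
      using a by (auto simp: f1_def f2_def)
    then have "L1_class M f = ns_add (L1 M) (ns_scale (L1 M) a (L1_class M f1))
        (ns_scale (L1 M) (1 - a) (L1_class M f2))"
      using int by (simp add: L1_scale L1_add)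
    then have "\<phi> = a *\<^sub>R T (L1_class M f1) + (1 - a) *\<^sub>R T (L1_class M f2)"
      using T_add T_scale int Tf by (metis L1_class_in_carrier scale_closed)
    then have "T (L1_class M f1) = T (L1_class M f)"
      unfolding Tf using norm1 norm2 T_norm int a
      by (intro ext[of _ "T (L1_class M f2)" a]) (auto simp: L1_class_in_carrier)
    then have "L1_class M f1 = L1_class M f"
      using bij f int by (auto simp: bij_betw_def inj_on_def L1_class_in_carrier)
    then have "AE x in M. f1 x = f x" using ae_eq_rel_class_eq[OF int(1) f] by simp
    \<comment> \<open>Extremality gives \<open>f1 = f\<close> almost everywhere, and
      \<open>f1\<close> vanishes off \<open>A\<close>; hence all the mass of \<open>f\<close> sits
      on \<open>A\<close>, contradicting \<open>a < s\<close>.\<close>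
    then have "AE x in M. \<bar>f x\<bar> = indicator A x * \<bar>f x\<bar>"
      by eventually_elim (auto simp: f1_def indicator_def split: if_splits)
    then have "s = a"
      unfolding s_def a_def mass_def using A f by (intro integral_cong_AE) auto
    with a show False by simp
  qed
  then have "atomic_support M f"
    using f s(1) unfolding atomic_support_def by (intro conjI exI[of _ s]) auto
  moreover have "\<not> (AE x in M. f x = 0)"
  proof
    assume "AE x in M. f x = 0"
    then have "s = 0"
      unfolding s_def using f by (subst integral_nonneg_eq_0_iff_AE) auto
    with s show False by simp
  qed
  ultimately show ?thesis by (rule that)
qed

text \<open>The restrictions of \<open>\<bar>g\<bar>\<close> to the atoms of its support,
  normalised, act as the unit vectors of \<open>ell1 k\<close>. Positivity of \<open>k\<close> is
  conditional because a null \<open>g\<close> has no atoms. The last clause serves to place a given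
  subspace inside \<open>E\<close>.\<close>

lemma atomic_support_imp_ell1_summand:
  assumes "atomic_support M g"
  obtains k E N where "\<not> (AE x in M. g x = 0) \<Longrightarrow> 0 < k"
    "lin_isometric ((L1 M)\<lparr>ns_carrier := E\<rparr>) (ell1 k)" "l1_direct_sum (L1 M) E N"
    "\<And>f. \<lbrakk>integrable M f; \<And>x. g x = 0 \<Longrightarrow> f x = 0\<rbrakk> \<Longrightarrow> L1_class M f \<in> E"
proof -
  interpret real_nspace "L1 M" by (rule real_nspace_L1)
  define G where "G = {x \<in> space M. g x \<noteq> 0}"
  have g: "integrable M g" using assms by (simp add: atomic_support_def)
  then have G: "G \<in> sets M" unfolding G_def by simp
  obtain \<epsilon> where \<epsilon>: "0 < \<epsilon>"
    "\<And>A. \<lbrakk>A \<in> sets M - null_sets M; A \<subseteq> {x. g x \<noteq> 0}\<rbrakk> \<Longrightarrow> \<epsilon> \<le> mass M g A"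
    using assms unfolding atomic_support_def by blast
  obtain n where n: "mass M g G < real n * \<epsilon>" using reals_Archimedean3[OF \<epsilon>(1)] by blast
  have large: "\<epsilon> \<le> mass M g A" if "A \<in> sets M - null_sets M" "A \<subseteq> G" for A
    using that by (intro \<epsilon>(2)) (auto simp: G_def)
  have "\<exists>\<A>. finite \<A> \<and> disjoint \<A> \<and> (\<forall>A\<in>\<A>. atom M A) \<and> \<Union>\<A> \<subseteq> G \<and> G - \<Union>\<A> \<in> null_sets M"
    by (rule atom_decomposition[OF g \<epsilon>(1) large G n])
  then obtain \<A> where "finite \<A>" and dis: "disjoint \<A>" and at: "\<forall>A\<in>\<A>. atom M A"
    and sub: "\<Union>\<A> \<subseteq> G" and null: "G - \<Union>\<A> \<in> null_sets M" by (elim exE conjE)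
  define k where "k = card \<A>"
  obtain A where bijA: "bij_betw A {0..<k} \<A>"
    using ex_bij_betw_nat_finite[OF \<open>finite \<A>\<close>] by (auto simp: k_def)
  have mem: "A i \<in> \<A>" if "i < k" for i using bijA that by (auto simp: bij_betw_def)
  then have A: "atom M (A i)" "A i \<subseteq> G" "A i \<in> sets M" if "i < k" for i
    using that at sub by (auto simp: atom_def)
  have Adis: "A i \<inter> A j = {}" if "i < k" "j < k" "i \<noteq> j" for i j
  proof (rule disjointD[OF dis mem mem])
    show "A i \<noteq> A j" using bijA that by (auto simp: bij_betw_def inj_on_def)
  qed fact+
  define U where "U = (\<Union>i<k. A i)"
  have "\<Union>\<A> = U" using bijA by (auto simp: U_def bij_betw_def atLeast0LessThan)
  with null have "G - U \<in> null_sets M" by simp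
  then have ae_U: "AE x in M. g x = 0 \<or> x \<in> U"
    using AE_not_in[of "G - U" M] AE_space[of M] by (auto simp: G_def elim: eventually_elim2)
  have U: "U \<in> sets M" using A by (auto simp: U_def)
  define m where "m i = mass M g (A i)" for i
  have m: "0 < m i" if "i < k" for i
    unfolding m_def using A[OF that] g by (intro mass_pos) (auto simp: atom_def G_def)
  \<comment> \<open>The \<open>w i\<close> are nonnegative, have integral 1 and live on disjoint
    atoms; \<open>P c\<close> is the combination with coefficients \<open>c\<close>.\<close>
  define w where "w i x = indicator (A i) x * \<bar>g x\<bar> / m i" for i x
  define P where "P c x = (\<Sum>i<k. c i * w i x)" for c x
  have w_int: "integrable M (w i)" "(\<integral>x. w i x \<partial>M) = 1" if "i < k" for i
    unfolding w_def using A(3)[OF that] g m[OF that] by (simp_all add: m_def mass_def)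
  have P_int: "integrable M (P c)" "(\<integral>x. P c x \<partial>M) = (\<Sum>i<k. c i)" for c
  proof -
    have int: "integrable M (\<lambda>x. c i * w i x)" if "i \<in> {..<k}" for i
      using w_int(1)[of i] that by simp
    show "integrable M (P c)"
      unfolding P_def[abs_def] by (intro Bochner_Integration.integrable_sum int)
    have "(\<integral>x. P c x \<partial>M) = (\<Sum>i<k. \<integral>x. c i * w i x \<partial>M)"
      unfolding P_def by (intro Bochner_Integration.integral_sum int)
    also have "\<dots> = (\<Sum>i<k. c i)"
      using w_int by (intro sum.cong) auto
    finally show "(\<integral>x. P c x \<partial>M) = (\<Sum>i<k. c i)" .
  qed
  have P_in: "P c x = c j * w j x" if "j < k" "x \<in> A j" for c j x
  proof -
    have "c i * w i x = 0" if "i \<in> {..<k} - {j}" for i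
      using Adis[of i j] that \<open>j < k\<close> \<open>x \<in> A j\<close> by (auto simp: w_def indicator_def)
    then have "(\<Sum>i\<in>{..<k} - {j}. c i * w i x) = 0" by (intro sum.neutral) blast
    then show ?thesis
      unfolding P_def using \<open>j < k\<close> sum.remove[of "{..<k}" j "\<lambda>i. c i * w i x"] by simp
  qed
  have P_out: "P c x = 0" if "x \<notin> U" for c x
    using that by (auto simp: P_def w_def U_def indicator_def intro!: sum.neutral)
  \<comment> \<open>At each point at most one term of the sum is nonzero. This makes the norm of
    \<open>P c\<close> equal to the sum of the \<open>\<bar>c i\<bar>\<close>.\<close>
  have P_abs: "\<bar>P c x\<bar> = P (\<lambda>i. \<bar>c i\<bar>) x" for c x
  proof (cases "x \<in> U")
    case True
    then obtain j where "j < k" "x \<in> A j" by (auto simp: U_def)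
    then show ?thesis using m[of j] by (simp add: P_in abs_mult w_def)
  qed (simp add: P_out)
  \<comment> \<open>The value 0 from index \<open>k\<close> on puts \<open>coef f\<close> into the
    carrier of \<open>ell1 k\<close>.\<close>
  define coef :: "('a \<Rightarrow> real) \<Rightarrow> nat \<Rightarrow> real"
    where "coef f i = (if i < k then \<integral>y. indicator (A i) y * f y \<partial>M else 0)" for f i
  \<comment> \<open>On each atom \<open>f\<close> is a multiple of \<open>\<bar>g\<bar>\<close>, and
    its integral there determines the multiple.\<close>
  have P_coef: "AE x in M. x \<in> U \<longrightarrow> P (coef f) x = f x" if f: "integrable M f" for f
  proof -
    have "AE x in M. i < k \<longrightarrow> x \<in> A i \<longrightarrow> f x = coef f i / m i * \<bar>g x\<bar>" for i
    proof (cases "i < k")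
      case True
      have "AE x in M. x \<in> A i \<longrightarrow> f x = coef f i / m i * \<bar>g x\<bar>"
        using atom_AE_proportional[OF A(1)[OF True] g f] A(2)[OF True] True
        by (auto simp: coef_def m_def G_def)
      then show ?thesis by eventually_elim simp
    qed simp
    then have "AE x in M. \<forall>i. i < k \<longrightarrow> x \<in> A i \<longrightarrow> f x = coef f i / m i * \<bar>g x\<bar>"
      by (simp add: AE_all_countable)
    then show ?thesis
    proof eventually_elim
      case (elim x)
      show ?case
      proof
        assume "x \<in> U"
        then obtain j where "j < k" "x \<in> A j" by (auto simp: U_def)
        then show "P (coef f) x = f x" using elim by (simp add: P_in w_def)
      qed
    qed
  qed
  define S where "S c = L1_class M (P c)" for c
  have coef_in: "coef f \<in> ns_carrier (ell1 k)" for f by (auto simp: ell1_def coef_def)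
  define E where "E = S ` ns_carrier (ell1 k)"
  have E: "linear_subspace (L1 M) E" and iso: "lin_isometric ((L1 M)\<lparr>ns_carrier := E\<rparr>) (ell1 k)"
  proof -
    have 1: "S a \<in> ns_carrier (L1 M)" for a
      using P_int by (simp add: S_def L1_class_in_carrier)
    have 2: "S (ns_add (ell1 k) a b) = ns_add (L1 M) (S a) (S b)" for a b
    proof -
      have "P (\<lambda>i. a i + b i) = (\<lambda>x. P a x + P b x)"
        by (simp add: P_def fun_eq_iff distrib_right sum.distrib)
      then show ?thesis using P_int by (simp add: S_def ell1_def L1_add)
    qed
    have 3: "S (ns_scale (ell1 k) c a) = ns_scale (L1 M) c (S a)" for c a
    proof -
      have "P (\<lambda>i. c * a i) = (\<lambda>x. c * P a x)"
        by (simp add: P_def fun_eq_iff sum_distrib_left mult.assoc)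
      then show ?thesis using P_int by (simp add: S_def ell1_def L1_scale)
    qed
    have 4: "ns_norm (L1 M) (S a) = ns_norm (ell1 k) a" for a
      using P_int by (simp add: S_def ell1_def L1_norm P_abs)
    show "linear_subspace (L1 M) E" "lin_isometric ((L1 M)\<lparr>ns_carrier := E\<rparr>) (ell1 k)"
      unfolding E_def by (rule lin_isometric_range[OF real_nspace_ell1 real_nspace_L1 1 2 3 4])+
  qed
  \<comment> \<open>One representative vanishing everywhere on \<open>U\<close> is enough, since
    classes ignore null sets.\<close>
  define N where "N = L1_class M ` {f. integrable M f \<and> (\<forall>x\<in>U. f x = 0)}"
  have N: "linear_subspace (L1 M) N"
    unfolding linear_subspace_def
  proof (intro conjI ballI allI)
    show "N \<subseteq> ns_carrier (L1 M)" by (auto simp: N_def L1_class_in_carrier)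
    show "ns_zero (L1 M) \<in> N" by (auto simp: N_def L1_zero)
    show "ns_add (L1 M) x y \<in> N" if "x \<in> N" "y \<in> N" for x y
      using that by (auto simp: N_def L1_add)
    show "ns_scale (L1 M) c x \<in> N" if "x \<in> N" for c x
      using that by (auto simp: N_def L1_scale)
  qed
  have sum: "l1_direct_sum (L1 M) E N"
  proof (rule l1_direct_sumI[OF E N])
    fix x assume "x \<in> ns_carrier (L1 M)"
    then obtain f where f: "integrable M f" "x = L1_class M f" by (auto simp: L1_carrier)
    define r where "r = (\<lambda>x. f x - indicator U x * f x)"
    have r: "integrable M r" unfolding r_def using f U by simp
    have "AE x in M. f x = P (coef f) x + r x"
      using P_coef[OF f(1)]
    proof eventually_elim
      case (elim x)
      then show ?case by (cases "x \<in> U") (auto simp: r_def P_out)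
    qed
    then have "x = ns_add (L1 M) (S (coef f)) (L1_class M r)"
      using f r P_int by (simp add: S_def L1_add ae_eq_rel_class_eq)
    moreover have "S (coef f) \<in> E" using coef_in by (simp add: E_def)
    moreover have "L1_class M r \<in> N" using r by (auto simp: N_def r_def)
    ultimately show "\<exists>e\<in>E. \<exists>n\<in>N. x = ns_add (L1 M) e n" by blast
  next
    fix e n assume "e \<in> E" "n \<in> N"
    then obtain c f where cf: "e = L1_class M (P c)" "n = L1_class M f" "integrable M f" "\<forall>x\<in>U. f x = 0"
      by (auto simp: E_def N_def S_def)
    have "\<bar>P c x + f x\<bar> = \<bar>P c x\<bar> + \<bar>f x\<bar>" for x
      using cf(4) P_out[of x c] by (cases "x \<in> U") auto
    then show "ns_norm (L1 M) (ns_add (L1 M) e n) = ns_norm (L1 M) e + ns_norm (L1 M) n"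
      using cf P_int by (simp add: L1_add L1_norm)
  qed
  show thesis
  proof (rule that[OF _ iso sum])
    \<comment> \<open>For \<open>k = 0\<close> the set \<open>U\<close> is empty, so
      \<open>ae_U\<close> would make \<open>g\<close> vanish almost everywhere.\<close>
    show "0 < k" if "\<not> (AE x in M. g x = 0)"
      using that ae_U by (cases k) (auto simp: U_def)
    show "L1_class M f \<in> E" if f: "integrable M f" and supp: "\<And>x. g x = 0 \<Longrightarrow> f x = 0" for f
    proof -
      have "AE x in M. f x = P (coef f) x"
        using P_coef[OF f] ae_U
      proof eventually_elim
        case (elim x)
        then show ?case using supp[of x] P_out[of x "coef f"] by (cases "x \<in> U") auto
      qed
      then have "L1_class M f = S (coef f)"
        using f P_int by (simp add: S_def ae_eq_rel_class_eq)
      then show ?thesis using coef_in by (simp add: E_def)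
    qed
  qed
qed

text \<open>Nontriviality excludes the zero space: its only vector is an SSD-point, but it contains
  no copy of \<open>ell1 k\<close> with \<open>k > 0\<close>.\<close>

theorem proposition2p12:
  fixes M :: "'a measure" and F :: "('a \<Rightarrow> real) set set"
  assumes "ns_carrier (L1 M) \<noteq> {ns_zero (L1 M)}"
    and "is_dual_of (L1 M) TYPE('x::banach)"
    and "closed_subspace (L1 M) F"
    and "finite_dimensional (L1 M) F"
  shows "(\<forall>f\<in>F. SSD_point (L1 M) f) \<longleftrightarrow>
    (\<exists>k>0. \<exists>E N. lin_isometric ((L1 M)\<lparr>ns_carrier := E\<rparr>) (ell1 k) \<and> F \<subseteq> E \<and>
       l1_direct_sum (L1 M) E N)"
proof
  assume ssd: "\<forall>f\<in>F. SSD_point (L1 M) f"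
  obtain B where B: "finite B" "B \<subseteq> ns_carrier (L1 M)" "F = linear_subspace (L1 M) hull B"
    using assms(4) unfolding finite_dimensional_def by blast
  have "\<forall>b\<in>B. \<exists>f. integrable M f \<and> b = L1_class M f" using B(2) by (auto simp: L1_carrier)
  then obtain r where r: "\<And>b. b \<in> B \<Longrightarrow> integrable M (r b)" "\<And>b. b \<in> B \<Longrightarrow> b = L1_class M (r b)"
    by metis
  have "atomic_support M (r b)" if "b \<in> B" for b
  proof -
    have "b \<in> F" using B(3) that by (simp add: hull_inc)
    then show ?thesis using SSD_point_imp_atomic_support[OF r(1)[OF that]] r(2)[OF that] ssd by simp
  qed
  then have "atomic_support M (\<lambda>x. \<Sum>b\<in>B. \<bar>r b x\<bar>)" by (rule atomic_support_sum[OF B(1)])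
  \<comment> \<open>\<open>f0\<close> guarantees an atom, hence \<open>k > 0\<close>, even if all
    generators of \<open>F\<close> are zero.\<close>
  moreover obtain f0 where f0: "atomic_support M f0" "\<not> (AE x in M. f0 x = 0)"
    using dual_L1_atomic_support[OF assms(1,2)] by blast
  ultimately have supp: "atomic_support M (\<lambda>x. \<bar>\<Sum>b\<in>B. \<bar>r b x\<bar>\<bar> + \<bar>f0 x\<bar>)"
    by (intro atomic_support_add)
  let ?g = "\<lambda>x. \<bar>\<Sum>b\<in>B. \<bar>r b x\<bar>\<bar> + \<bar>f0 x\<bar>"
  obtain k E N where k: "\<not> (AE x in M. ?g x = 0) \<Longrightarrow> 0 < k"
    and iso: "lin_isometric ((L1 M)\<lparr>ns_carrier := E\<rparr>) (ell1 k)" and sum: "l1_direct_sum (L1 M) E N"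
    and E: "\<And>f. \<lbrakk>integrable M f; \<And>x. ?g x = 0 \<Longrightarrow> f x = 0\<rbrakk> \<Longrightarrow> L1_class M f \<in> E"
    using atomic_support_imp_ell1_summand[OF supp] by blast
  have "\<not> (AE x in M. ?g x = 0)"
  proof
    assume "AE x in M. ?g x = 0"
    then have "AE x in M. f0 x = 0"
    proof eventually_elim
      case (elim x)
      then show ?case by linarith
    qed
    with f0 show False by simp
  qed
  then have "0 < k" by (rule k)
  \<comment> \<open>\<open>E\<close> is a subspace and \<open>F\<close> is the hull of
    \<open>B\<close>, so it suffices to place the generators; each of them vanishes wherever the sum
    of absolute values does.\<close>
  have "b \<in> E" if b: "b \<in> B" for b
  proof -
    have "r b x = 0" if "?g x = 0" for x
    proof -
      have "(\<Sum>b\<in>B. \<bar>r b x\<bar>) = 0" using that by linarith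
      then show ?thesis using b B(1) by (simp add: sum_nonneg_eq_0_iff)
    qed
    then have "L1_class M (r b) \<in> E" by (intro E r b)
    then show ?thesis using r(2)[OF b] by simp
  qed
  then have "F \<subseteq> E"
    unfolding B(3) using sum
    by (intro hull_minimal) (auto simp: l1_direct_sum_def closed_subspace_def)
  with \<open>0 < k\<close> iso sum
  show "\<exists>k>0. \<exists>E N. lin_isometric ((L1 M)\<lparr>ns_carrier := E\<rparr>) (ell1 k) \<and> F \<subseteq> E \<and>
       l1_direct_sum (L1 M) E N" by blast
next
  assume "\<exists>k>0. \<exists>E N. lin_isometric ((L1 M)\<lparr>ns_carrier := E\<rparr>) (ell1 k) \<and> F \<subseteq> E \<and>
       l1_direct_sum (L1 M) E N"
  then show "\<forall>f\<in>F. SSD_point (L1 M) f"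
    using real_nspace.SSD_point_ell1_summand[OF real_nspace_L1] by blast
qed

end
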